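(* Let $C$ denote any (polytopal) subdivision of a convex $d$-polytope. Then $\mathrm{sd}\, C$ is collapsible.
   Context: A polytopal complex is a finite collection of convex polytopes in $\mathbb{R}^n$, closed under taking faces, such that the intersection of any two of them is a face of both. A $d$-polytope is a $d$-dimensional convex polytope, identified with the polytopal complex of its faces. A subdivision of a $d$-polytope $P$ is a polytopal complex $C$ with underlying space $P$ (its faces need not be simplices). A derived subdivision $\mathrm{sd}\, C$ is any subdivision obtained by stellarly subdividing all faces of $C$ in order of decreasing dimension. Equivalently, one chooses a point in the relative interior of each nonempty face, and the simplices are the convex hulls of the points corresponding to chains of nonempty faces; its face poset is that of the order complex of the poset of nonempty faces of $C$. A free face $\sigma$ of a complex is a nonempty face strictly contained in exactly one other face. An elementary collapse deletes a free face $\sigma$ (together with the unique face strictly containing it). A complex is collapsible if it can be reduced to a single vertex by a sequence of elementary collapses. *)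

theory Defs
  imports "HOL-Analysis.Analysis"
begin

(* "face_of" counts the empty set and the polytope itself as faces, so every nonempty
   polytopal complex contains the empty set. *)
definition polytopal_complex :: "'a::euclidean_space set set \<Rightarrow> bool" where
  "polytopal_complex C \<longleftrightarrow>
     finite C \<and>
     (\<forall>F\<in>C. polytope F) \<and>
     (\<forall>F\<in>C. \<forall>G. G face_of F \<longrightarrow> G \<in> C) \<and>
     (\<forall>F\<in>C. \<forall>G\<in>C. (F \<inter> G) face_of F \<and> (F \<inter> G) face_of G)"

definition polytopal_subdivision :: "'a::euclidean_space set set \<Rightarrow> 'a set \<Rightarrow> bool" where
  "polytopal_subdivision C P \<longleftrightarrow> polytopal_complex C \<and> \<Union>C = P"

(* D is a derived subdivision of C for some choice p of a relative interior point in every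
   nonempty face.  The faces of D are the convex hulls of the points chosen for a chain of
   nonempty faces; the empty chain contributes the empty face. *)
definition derived_subdivision :: "'a::euclidean_space set set \<Rightarrow> 'a set set \<Rightarrow> bool" where
  "derived_subdivision C D \<longleftrightarrow>
     (\<exists>p. (\<forall>F \<in> C - {{}}. p F \<in> rel_interior F) \<and>
          D = (\<lambda>c. convex hull (p ` c)) ` chains (C - {{}}))"

(* In a polytopal complex, a face that is contained in another one is a face of it, so the
   face relation is plain inclusion of sets. *)
definition free_face :: "'a::euclidean_space set set \<Rightarrow> 'a set \<Rightarrow> bool" where
  "free_face K \<sigma> \<longleftrightarrow> \<sigma> \<in> K \<and> \<sigma> \<noteq> {} \<and> (\<exists>!\<tau>. \<tau> \<in> K \<and> \<sigma> \<subset> \<tau>)"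

definition elementary_collapse :: "'a::euclidean_space set set \<Rightarrow> 'a set set \<Rightarrow> bool" where
  "elementary_collapse K L \<longleftrightarrow>
     (\<exists>\<sigma> \<tau>. free_face K \<sigma> \<and> \<tau> \<in> K \<and> \<sigma> \<subset> \<tau> \<and> L = K - {\<sigma>, \<tau>})"

(* A single vertex, as a complex, still has the empty face. *)
definition collapsible :: "'a::euclidean_space set set \<Rightarrow> bool" where
  "collapsible K \<longleftrightarrow> (\<exists>v. elementary_collapse\<^sup>*\<^sup>* K {{}, {v}})"

end

theory Submission
  imports Defs
begin

text \<open>The simplices of a derived subdivision correspond to the chains of nonempty faces of \<open>C\<close>, so the claim is
about the order complex of these faces.  A vertex of a complex can be removed by collapses whenever its
link collapses to a point (\<open>nonevasive_imp_collapse\<close>); in an order complex, the link of \<open>x\<close> belongs to the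
elements comparable to \<open>x\<close>.  It therefore suffices to find an order in which the faces of \<open>C\<close> can be deleted
such that all links met on the way are again of this kind.

Such an order comes from sweeping the polytope downwards with a generic linear functional.  When the sweep
passes a vertex \<open>v\<close>, the faces that have their minimum at \<open>v\<close> are deleted, \<open>v\<close> itself last.  Among the
faces still present, one with minimum at \<open>v\<close> is comparable only to faces that contain \<open>v\<close>, so its link is a cone with apex \<open>v\<close>.  Then
the link of \<open>v\<close> consists of the faces through \<open>v\<close> that reach below \<open>v\<close>.  Their tangent cones, cut with a
hyperplane just below \<open>v\<close>, form a complex of smaller dimension with the same order
(\<open>nonevasive_descending_link\<close>).  Its union is a slice of the tangent cone of the polytope, hence convex, and
induction on the dimension applies.

These slices are in general unbounded, which is why the induction runs over finite complexes of polyhedra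
with convex union (\<open>nonevasive_cell_complex\<close>).  In such a complex the sweep may end with faces on which the
functional is unbounded below.  All of them, and no other remaining faces, are met by a hyperplane far down,
so the induction hypothesis for that slice finishes the argument (\<open>nonevasive_sublevel\<close>).

Finally, the convex hulls of the chosen points determine the chains (\<open>mem_chain_if_in_convex_hull\<close>), so the
collapses of chains become collapses of the derived subdivision.\<close>

section \<open>Collapses of order complexes\<close>

text \<open>The relation \<^const>\<open>elementary_collapse\<close> with the convex hulls stripped off: it acts on families of sets of any
type, so that it also applies to the order complex itself, whose faces are chains.\<close>
definition collapse_step :: "'b set set \<Rightarrow> 'b set set \<Rightarrow> bool" where
  "collapse_step K L \<longleftrightarrow>
     (\<exists>\<sigma> \<tau>. \<sigma> \<in> K \<and> \<sigma> \<noteq> {} \<and> \<tau> \<in> K \<and> \<sigma> \<subset> \<tau> \<and> (\<forall>\<rho>\<in>K. \<sigma> \<subset> \<rho> \<longrightarrow> \<rho> = \<tau>) \<and>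
        L = K - {\<sigma>, \<tau>})"

definition comparables :: "'b set set \<Rightarrow> 'b set \<Rightarrow> 'b set set" where
  "comparables Q x = {y \<in> Q. x \<subset> y \<or> y \<subset> x}"

text \<open>Nonevasiveness of the order complex of \<open>Q\<close>, ordered by inclusion, spelled out on \<open>Q\<close> itself: the
link of the vertex \<open>x\<close> in the order complex is the order complex of the elements comparable to \<open>x\<close>.\<close>
inductive nonevasive :: "'b set set \<Rightarrow> bool" where
  single: "nonevasive {x}"
| remove: "x \<in> Q \<Longrightarrow> nonevasive (comparables Q x) \<Longrightarrow> nonevasive (Q - {x}) \<Longrightarrow> nonevasive Q"

lemma collapse_step_subset: "collapse_step K L \<Longrightarrow> L \<subseteq> K"
  by (auto simp: collapse_step_def)

lemma collapse_steps_subset: "collapse_step\<^sup>*\<^sup>* K L \<Longrightarrow> L \<subseteq> K"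
  by (induction rule: rtranclp_induct) (auto dest: collapse_step_subset)

text \<open>A collapse of the link of \<open>x\<close> lifts to the star of \<open>x\<close>: a face that strictly contains \<open>\<sigma> \<union> {x}\<close> contains
\<open>x\<close>, so it comes from a face of the link that strictly contains \<open>\<sigma>\<close>.  The faces \<open>B\<close> that avoid \<open>x\<close>
cannot interfere.\<close>
lemma collapse_step_insert:
  assumes "collapse_step L L'" and x: "\<And>s. s \<in> B \<union> L \<Longrightarrow> x \<notin> s"
  shows "collapse_step (B \<union> insert x ` L) (B \<union> insert x ` L')"
proof -
  from assms(1) obtain \<sigma> \<tau> where st: "\<sigma> \<in> L" "\<tau> \<in> L" "\<sigma> \<subset> \<tau>"
    and free: "\<And>\<rho>. \<rho> \<in> L \<Longrightarrow> \<sigma> \<subset> \<rho> \<Longrightarrow> \<rho> = \<tau>" and L': "L' = L - {\<sigma>, \<tau>}"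
    unfolding collapse_step_def by blast
  have inj: "inj_on (insert x) L"
  proof (rule inj_onI)
    fix s t assume "s \<in> L" "t \<in> L" "insert x s = insert x t"
    moreover from this have "x \<notin> s" "x \<notin> t" using x by blast+
    ultimately show "s = t" by (simp add: insert_ident)
  qed
  show ?thesis
    unfolding collapse_step_def
  proof (intro exI conjI ballI impI)
    show "insert x \<sigma> \<in> B \<union> insert x ` L" "insert x \<tau> \<in> B \<union> insert x ` L" "insert x \<sigma> \<noteq> {}"
      using st by auto
    show "insert x \<sigma> \<subset> insert x \<tau>"
      using st x by (metis UnI2 insert_mono insert_ident psubset_eq)
  next
    fix \<rho> assume \<rho>: "\<rho> \<in> B \<union> insert x ` L" "insert x \<sigma> \<subset> \<rho>"
    then obtain s where s: "s \<in> L" "\<rho> = insert x s"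
      using x by blast
    then have "\<sigma> \<subset> s"
      using \<rho> x[of s] x[of \<sigma>] st by blast
    then show "\<rho> = insert x \<tau>" using free s by blast
  next
    have "insert x ` L' = insert x ` L - {insert x \<sigma>, insert x \<tau>}"
      unfolding L' using inj st by (auto simp: inj_on_def)
    moreover have "B \<inter> {insert x \<sigma>, insert x \<tau>} = {}"
      using x by blast
    ultimately show "B \<union> insert x ` L' = B \<union> insert x ` L - {insert x \<sigma>, insert x \<tau>}"
      by blast
  qed
qed

lemma collapse_steps_insert:
  assumes "collapse_step\<^sup>*\<^sup>* L L'" and x: "\<And>s. s \<in> B \<union> L \<Longrightarrow> x \<notin> s"
  shows "collapse_step\<^sup>*\<^sup>* (B \<union> insert x ` L) (B \<union> insert x ` L')"
  using assms(1)
proof (induction rule: rtranclp_induct)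
  case (step M N)
  have "collapse_step (B \<union> insert x ` M) (B \<union> insert x ` N)"
    using x collapse_steps_subset[OF step.hyps(1)]
    by (intro collapse_step_insert[OF step.hyps(2)]) auto
  with step.IH show ?case by (rule rtranclp.rtrancl_into_rtrancl)
qed simp

lemma chains_split:
  assumes "x \<in> Q"
  shows "chains Q = chains (Q - {x}) \<union> insert x ` chains (comparables Q x)"
proof (intro equalityI subsetI)
  fix c assume c: "c \<in> chains Q"
  show "c \<in> chains (Q - {x}) \<union> insert x ` chains (comparables Q x)"
  proof (cases "x \<in> c")
    case True
    have "c - {x} \<in> chains (comparables Q x)"
      using c True unfolding chains_def chain_subset_def comparables_def by blast
    with True show ?thesis by (metis UnI2 imageI insert_Diff)
  next
    case False
    then show ?thesis using c by (auto simp: chains_def)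
  qed
next
  fix c assume "c \<in> chains (Q - {x}) \<union> insert x ` chains (comparables Q x)"
  then show "c \<in> chains Q"
    using assms unfolding chains_def chain_subset_def comparables_def by blast
qed

text \<open>Coning the collapse of the link reduces the star of \<open>x\<close> to the single edge \<open>{x, w}\<close>; then \<open>x\<close> is a free
face, and one more collapse removes \<open>x\<close> altogether.\<close>
lemma nonevasive_imp_collapse:
  "nonevasive Q \<Longrightarrow> \<exists>w\<in>Q. collapse_step\<^sup>*\<^sup>* (chains Q) {{}, {w}}"
proof (induction rule: nonevasive.induct)
  case (single x)
  have "chains {x} = {{}, {x}}"
    by (auto simp: chains_def chain_subset_def)
  then show ?case by simp
next
  case (remove x Q)
  from remove.IH obtain w u where
    w: "w \<in> comparables Q x" "collapse_step\<^sup>*\<^sup>* (chains (comparables Q x)) {{}, {w}}" and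
    u: "u \<in> Q - {x}" "collapse_step\<^sup>*\<^sup>* (chains (Q - {x})) {{}, {u}}"
    by blast
  have x: "x \<notin> s" if "s \<in> chains (Q - {x}) \<union> chains (comparables Q x)" for s
    using that by (auto simp: chains_def comparables_def)
  have "collapse_step\<^sup>*\<^sup>* (chains Q) (chains (Q - {x}) \<union> insert x ` {{}, {w}})"
    unfolding chains_split[OF remove.hyps(1)] using w(2) x by (rule collapse_steps_insert)
  moreover have "collapse_step (chains (Q - {x}) \<union> insert x ` {{}, {w}}) (chains (Q - {x}))"
    unfolding collapse_step_def
  proof (intro exI conjI ballI impI)
    show "{x} \<in> chains (Q - {x}) \<union> insert x ` {{}, {w}}" "{x, w} \<in> chains (Q - {x}) \<union> insert x ` {{}, {w}}"
      by auto
    show "{x} \<subset> {x, w}" using w by (auto simp: comparables_def)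
    show "chains (Q - {x}) = chains (Q - {x}) \<union> insert x ` {{}, {w}} - {{x}, {x, w}}"
      using x by auto
  qed (use x in auto)
  ultimately show ?case using u by (meson DiffE converse_rtranclp_into_rtranclp rtranclp_trans)
qed

lemma nonevasive_order_embedding:
  assumes "nonevasive (h ` R)"
    and "\<And>F G. F \<in> R \<Longrightarrow> G \<in> R \<Longrightarrow> h F \<subseteq> h G \<longleftrightarrow> F \<subseteq> G"
  shows "nonevasive R"
  using assms
proof (induction "h ` R" arbitrary: R rule: nonevasive.induct)
  case (single x)
  have "F = G" if "F \<in> R" "G \<in> R" for F G
    using single that by (metis image_eqI singletonD subset_antisym subset_refl)
  moreover have "R \<noteq> {}" using single by auto
  ultimately obtain y where "R = {y}" by blast
  then show ?case by (simp add: nonevasive.single)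
next
  case (remove x)
  then obtain y where y: "y \<in> R" "x = h y" by auto
  have inj: "F = G" if "F \<in> R" "G \<in> R" "h F = h G" for F G
    using remove.prems that by (metis subset_antisym subset_refl)
  have "comparables (h ` R) x = h ` comparables R y"
    using remove.prems y inj unfolding comparables_def psubset_eq by blast
  moreover have "h ` R - {x} = h ` (R - {y})"
    using y inj by blast
  moreover have "comparables R y \<subseteq> R" by (auto simp: comparables_def)
  ultimately have "nonevasive (comparables R y)" "nonevasive (R - {y})"
    using remove.hyps(3)[of "comparables R y"] remove.hyps(5)[of "R - {y}"] remove.prems y
    by (simp_all add: subset_iff)
  with y(1) show ?case by (rule nonevasive.remove)
qed

text \<open>Any element other than the apex \<open>v\<close> can be removed first, since its link and the rest are smaller cones with
the same apex.\<close>
lemma nonevasive_cone: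
  assumes "finite Q" "v \<in> Q" "\<And>y. y \<in> Q \<Longrightarrow> y \<subseteq> v \<or> v \<subseteq> y"
  shows "nonevasive Q"
  using assms
proof (induction Q rule: finite_psubset_induct)
  case (psubset Q)
  show ?case
  proof (cases "Q = {v}")
    case True
    then show ?thesis by (simp add: nonevasive.single)
  next
    case False
    then obtain x where x: "x \<in> Q" "x \<noteq> v" using psubset.prems by auto
    have "nonevasive (comparables Q x)"
      using psubset.prems x by (intro psubset.IH) (auto simp: comparables_def)
    moreover have "nonevasive (Q - {x})"
      using psubset.prems x by (intro psubset.IH) auto
    ultimately show ?thesis using x by (auto intro: nonevasive.remove)
  qed
qed

text \<open>The order in which the elements of \<open>X\<close> are removed does not matter: the link of each of them is, at every
stage, a cone with apex \<open>v\<close>.\<close>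
lemma nonevasive_remove_cones:
  assumes "finite X" "finite Q" "X \<subseteq> Q" "v \<in> Q - X"
    and "\<And>x. x \<in> X \<Longrightarrow> v \<in> comparables Q x"
    and "\<And>x y. x \<in> X \<Longrightarrow> y \<in> comparables Q x \<Longrightarrow> y \<subseteq> v \<or> v \<subseteq> y"
    and "nonevasive (Q - X)"
  shows "nonevasive Q"
  using assms
proof (induction X arbitrary: Q rule: finite_induct)
  case (insert x X)
  have eq: "Q - {x} - X = Q - insert x X" by blast
  have sub: "comparables (Q - {x}) y \<subseteq> comparables Q y" for y
    by (auto simp: comparables_def)
  have "nonevasive (Q - {x})"
  proof (rule insert.IH)
    show "finite (Q - {x})" "X \<subseteq> Q - {x}" "v \<in> Q - {x} - X"
      using insert.prems(1-3) insert.hyps by blast+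
    show "nonevasive (Q - {x} - X)"
      unfolding eq by (rule insert.prems(6))
    show "v \<in> comparables (Q - {x}) y" if "y \<in> X" for y
      using insert.prems(3) insert.prems(4)[of y] that by (simp add: comparables_def)
    show "z \<subseteq> v \<or> v \<subseteq> z" if "y \<in> X" "z \<in> comparables (Q - {x}) y" for y z
      using insert.prems(5)[of y z] sub that by blast
  qed
  moreover have "nonevasive (comparables Q x)"
  proof (rule nonevasive_cone)
    show "finite (comparables Q x)"
      using insert.prems(1) by (simp add: comparables_def)
    show "v \<in> comparables Q x"
      by (rule insert.prems(4)) simp
    show "y \<subseteq> v \<or> v \<subseteq> y" if "y \<in> comparables Q x" for y
      using that by (rule insert.prems(5)[OF insertI1])
  qed
  moreover have "x \<in> Q" using insert.prems(2) by blast
  ultimately show ?case using nonevasive.remove by metis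
qed simp

section \<open>Cell complexes and generic linear functionals\<close>

text \<open>Polyhedral complexes without the empty face, with cells that may be unbounded.  Instead of asking for all
faces of a cell and for face-to-face intersections, the two closing conditions are the consequences that
drive the induction; both pass directly to hyperplane slices and to tangent cones, where the faces
themselves would have to be computed anew.\<close>
definition cell_complex :: "'a::euclidean_space set set \<Rightarrow> bool" where
  "cell_complex C \<longleftrightarrow> finite C \<and>
     (\<forall>F\<in>C. polyhedron F \<and> F \<noteq> {} \<and> rel_frontier F \<subseteq> \<Union>{G \<in> C. G \<subset> F}) \<and>
     (\<forall>F\<in>C. \<forall>G\<in>C. rel_interior F \<inter> G \<noteq> {} \<longrightarrow> F \<subseteq> G)"

lemma cell_complexD:
  assumes "cell_complex C"
  shows "finite C" "F \<in> C \<Longrightarrow> polyhedron F" "F \<in> C \<Longrightarrow> F \<noteq> {}"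
    "F \<in> C \<Longrightarrow> convex F" "F \<in> C \<Longrightarrow> closed F"
    "F \<in> C \<Longrightarrow> G \<in> C \<Longrightarrow> x \<in> rel_interior F \<Longrightarrow> x \<in> G \<Longrightarrow> F \<subseteq> G"
proof -
  show "finite C" using assms by (simp add: cell_complex_def)
  have p: "polyhedron F \<and> F \<noteq> {}" if "F \<in> C" for F
    using assms that by (simp add: cell_complex_def)
  show "F \<in> C \<Longrightarrow> polyhedron F" "F \<in> C \<Longrightarrow> F \<noteq> {}" "F \<in> C \<Longrightarrow> convex F" "F \<in> C \<Longrightarrow> closed F"
    using p polyhedron_imp_convex polyhedron_imp_closed by blast+
  assume "F \<in> C" "G \<in> C" "x \<in> rel_interior F" "x \<in> G"
  moreover from this have "rel_interior F \<inter> G \<noteq> {}" by blast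
  ultimately show "F \<subseteq> G"
    using assms unfolding cell_complex_def by blast
qed

lemma cell_complex_boundary:
  assumes "cell_complex C" "F \<in> C" "x \<in> F" "x \<notin> rel_interior F"
  obtains G where "G \<in> C" "G \<subset> F" "x \<in> G"
proof -
  have "x \<in> rel_frontier F"
    using assms closure_subset by (auto simp: rel_frontier_def)
  moreover have "rel_frontier F \<subseteq> \<Union>{G \<in> C. G \<subset> F}"
    using assms(1,2) by (simp add: cell_complex_def)
  ultimately show ?thesis using that by blast
qed

lemma polytopal_complex_imp_cell_complex:
  assumes "polytopal_complex C"
  shows "cell_complex (C - {{}})"
  unfolding cell_complex_def
proof (intro conjI ballI impI)
  show "finite (C - {{}})" using assms by (simp add: polytopal_complex_def)
next
  fix F assume F: "F \<in> C - {{}}"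
  then show p: "polyhedron F" "F \<noteq> {}"
    using assms by (auto simp: polytopal_complex_def intro: polytope_imp_polyhedron)
  have "G \<in> C - {{}} \<and> G \<subset> F" if "G facet_of F" for G
    using that F assms face_of_imp_subset
    unfolding polytopal_complex_def facet_of_def by fastforce
  then show "rel_frontier F \<subseteq> \<Union>{G \<in> C - {{}}. G \<subset> F}"
    unfolding rel_frontier_of_polyhedron[OF p(1)] by blast
next
  fix F G assume "F \<in> C - {{}}" "G \<in> C - {{}}" and ne: "rel_interior F \<inter> G \<noteq> {}"
  then have "F \<inter> G face_of F" using assms by (auto simp: polytopal_complex_def)
  moreover have "F \<inter> G \<inter> rel_interior F \<noteq> {}"
    using ne rel_interior_subset by blast
  ultimately show "F \<subseteq> G" using subset_of_face_of by fastforce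
qed

lemma rel_interior_segment:
  fixes S :: "'a::euclidean_space set"
  assumes "convex S" "c \<in> rel_interior S" "x \<in> S" "0 < e" "e \<le> 1"
  shows "(1 - e) *\<^sub>R x + e *\<^sub>R c \<in> rel_interior S"
  using rel_interior_convex_shrink[OF assms] by (simp add: algebra_simps)

lemma rel_interior_halfspace_meets:
  fixes S :: "'a::euclidean_space set"
  assumes "convex S" "x \<in> S" "a \<bullet> x < s"
  obtains x' where "x' \<in> rel_interior S" "a \<bullet> x' < s"
proof -
  have "x \<in> closure (rel_interior S)"
    using assms closure_subset convex_closure_rel_interior by blast
  then have "{x. a \<bullet> x < s} \<inter> rel_interior S \<noteq> {}"
    using assms(3) open_Int_closure_eq_empty[OF open_halfspace_lt[of a s], of "rel_interior S"]
    by blast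
  then show ?thesis using that by blast
qed

lemma rel_interior_meets_hyperplane:
  fixes S :: "'a::euclidean_space set"
  assumes "convex S" "x \<in> S" "a \<bullet> x < s" "y \<in> S" "s < a \<bullet> y"
  obtains z where "z \<in> rel_interior S" "a \<bullet> z = s"
proof -
  obtain x' where x': "x' \<in> rel_interior S" "a \<bullet> x' < s"
    using rel_interior_halfspace_meets assms by blast
  have "(- a) \<bullet> y < - s" using assms by simp
  then obtain y' where y': "y' \<in> rel_interior S" "(- a) \<bullet> y' < - s"
    using rel_interior_halfspace_meets assms(1,4) by blast
  have "\<exists>z\<in>rel_interior S. a \<bullet> z = s"
    using x' y' convex_rel_interior[OF assms(1)] convex_connected
    by (intro connected_ivt_hyperplane[of _ x' y']) auto
  then show ?thesis using that by blast
qed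

lemma ex_generic_vector:
  fixes W :: "'a::euclidean_space set"
  assumes "finite W" "0 \<notin> W"
  shows "\<exists>a. \<forall>w\<in>W. a \<bullet> w \<noteq> 0"
proof -
  have "negligible (\<Union>w\<in>W. {a. w \<bullet> a = 0})"
    using assms by (intro negligible_Union) (auto intro: negligible_hyperplane)
  then have "(\<Union>w\<in>W. {a. w \<bullet> a = 0}) \<noteq> UNIV"
    by (metis non_negligible_UNIV)
  then obtain a where "a \<notin> (\<Union>w\<in>W. {a. w \<bullet> a = 0})" by blast
  then show ?thesis by (intro exI[of _ a]) (simp add: inner_commute)
qed

lemma finite_vertices: "cell_complex C \<Longrightarrow> finite {v. {v} \<in> C}"
  using finite_inverse_image[of C "\<lambda>v. {v}"] cell_complexD(1) by (auto simp: inj_on_def)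

text \<open>Each of the two demands excludes finitely many proper subspaces: a difference of two vertices, or of two
points of a positive-dimensional cell, must not be orthogonal to \<open>a\<close>.\<close>
lemma ex_generic_functional:
  fixes C :: "'a::euclidean_space set set"
  assumes "cell_complex C"
  shows "\<exists>a. (\<forall>v w. {v} \<in> C \<longrightarrow> {w} \<in> C \<longrightarrow> a \<bullet> v = a \<bullet> w \<longrightarrow> v = w) \<and>
    (\<forall>F\<in>C. (\<forall>x\<in>F. \<forall>y\<in>F. a \<bullet> x = a \<bullet> y) \<longrightarrow> (\<exists>v. F = {v}))"
proof -
  let ?V = "{v. {v} \<in> C}"
  let ?N = "{F \<in> C. \<exists>x\<in>F. \<exists>y\<in>F. x \<noteq> y}"
  have "\<forall>F\<in>?N. \<exists>d. d \<noteq> 0 \<and> (\<exists>x\<in>F. \<exists>y\<in>F. d = x - y)"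
  proof
    fix F assume "F \<in> ?N"
    then obtain x y where "x \<in> F" "y \<in> F" "x - y \<noteq> 0" by auto
    then show "\<exists>d. d \<noteq> 0 \<and> (\<exists>x\<in>F. \<exists>y\<in>F. d = x - y)" by blast
  qed
  from bchoice[OF this]
  obtain d where d: "\<forall>F\<in>?N. d F \<noteq> 0 \<and> (\<exists>x\<in>F. \<exists>y\<in>F. d F = x - y)" ..
  let ?W = "((\<lambda>(v, w). v - w) ` (?V \<times> ?V) - {0}) \<union> d ` ?N"
  have "finite ?W" using finite_vertices[OF assms] cell_complexD(1)[OF assms] by auto
  moreover have "0 \<notin> d ` ?N"
  proof
    assume "0 \<in> d ` ?N"
    then obtain F where F: "0 = d F" "F \<in> ?N" by (rule imageE)
    from bspec[OF d F(2)] F(1) show False by simp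
  qed
  then have "0 \<notin> ?W" by blast
  ultimately have "\<exists>a. \<forall>w\<in>?W. a \<bullet> w \<noteq> 0"
    by (rule ex_generic_vector)
  then obtain a where "\<forall>w\<in>?W. a \<bullet> w \<noteq> 0" ..
  then have a: "\<And>w. w \<in> ?W \<Longrightarrow> a \<bullet> w \<noteq> 0" by (rule bspec)
  show ?thesis
  proof (rule exI[of _ a], intro conjI allI ballI impI)
    fix v w assume vw: "{v} \<in> C" "{w} \<in> C" "a \<bullet> v = a \<bullet> w"
    show "v = w"
    proof (rule ccontr)
      assume "v \<noteq> w"
      have "(v, w) \<in> ?V \<times> ?V" using vw(1,2) by simp
      then have "v - w \<in> (\<lambda>(v, w). v - w) ` (?V \<times> ?V)" by (rule rev_image_eqI) simp
      then have "v - w \<in> ?W" using \<open>v \<noteq> w\<close> by simp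
      then have "a \<bullet> (v - w) \<noteq> 0" by (rule a)
      then show False using vw(3) by (simp add: inner_diff_right)
    qed
  next
    fix F assume F: "F \<in> C" "\<forall>x\<in>F. \<forall>y\<in>F. a \<bullet> x = a \<bullet> y"
    have "F \<notin> ?N"
    proof
      assume N: "F \<in> ?N"
      from bspec[OF d N] obtain x y where xy: "x \<in> F" "y \<in> F" "d F = x - y" by blast
      have "d F \<in> d ` ?N" using N by (rule imageI)
      then have "a \<bullet> d F \<noteq> 0" by (intro a UnI2)
      moreover have "a \<bullet> x = a \<bullet> y" using F(2) xy(1,2) by blast
      ultimately show False using xy(3) by (simp add: inner_diff_right)
    qed
    then show "\<exists>v. F = {v}" using F cell_complexD(3)[OF assms F(1)] by blast
  qed
qed

text \<open>Along the direction \<open>p - q\<close> the functional decreases at a constant rate, so its lower bound \<open>m\<close> forces the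
ray from \<open>x\<close> to leave \<open>F\<close>, and it does so at a point outside the relative interior.\<close>
lemma descend_to_boundary:
  fixes a :: "'a::euclidean_space"
  assumes "convex F" "closed F" "x \<in> F" "\<And>y. y \<in> F \<Longrightarrow> m \<le> a \<bullet> y"
    "p \<in> F" "q \<in> F" "a \<bullet> p < a \<bullet> q"
  obtains z where "z \<in> F" "z \<notin> rel_interior F" "a \<bullet> z \<le> a \<bullet> x"
proof -
  define u where "u = p - q"
  have u: "a \<bullet> u < 0" using assms by (simp add: u_def inner_diff_right)
  \<comment> \<open>At parameter \<open>T\<close> the bound \<open>m\<close> is reached, so \<open>L\<close> contains every parameter for which the ray is in \<open>F\<close>.\<close>
  define T where "T = (m - a \<bullet> x) / (a \<bullet> u)"
  define L where "L = {0..T} \<inter> (\<lambda>t. x + t *\<^sub>R u) -` F"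
  have T: "0 \<le> T" using u assms(3,4) by (simp add: T_def divide_nonpos_neg)
  have "closed ((\<lambda>t. x + t *\<^sub>R u) -` F)"
    using assms(2) by (intro continuous_closed_vimage) (auto intro!: continuous_intros)
  then have "compact L" unfolding L_def by (intro compact_Int_closed) auto
  moreover have "0 \<in> L" using assms T by (simp add: L_def)
  ultimately obtain t where t: "t \<in> L" "\<And>t'. t' \<in> L \<Longrightarrow> t' \<le> t"
    using compact_attains_sup[of L] by blast
  define z where "z = x + t *\<^sub>R u"
  have zF: "z \<in> F" using t by (simp add: L_def z_def)
  have in_L: "t' \<in> L" if "0 \<le> t'" "x + t' *\<^sub>R u \<in> F" for t'
  proof -
    have "m \<le> a \<bullet> x + t' * (a \<bullet> u)"
      using assms(4)[OF that(2)] by (simp add: inner_add_right)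
    then have "t' \<le> T" using u by (simp add: T_def neg_le_divide_eq algebra_simps)
    then show ?thesis using that by (simp add: L_def)
  qed
  have "z \<notin> rel_interior F"
  proof
    assume z: "z \<in> rel_interior F"
    have "z + 1 *\<^sub>R (q - p) \<in> affine hull F"
      using zF assms by (intro mem_affine_3_minus) (auto intro: hull_inc)
    then have "z - u \<in> affine hull F" by (simp add: u_def algebra_simps)
    \<comment> \<open>A relative interior point could be pushed further along \<open>u\<close>, against the maximality of \<open>t\<close>.\<close>
    then obtain e where e: "e > 1" "(1 - e) *\<^sub>R (z - u) + e *\<^sub>R z \<in> F"
      using z convex_rel_interior_iff2[OF assms(1)] assms(3) by blast
    have "(1 - e) *\<^sub>R (z - u) + e *\<^sub>R z = x + (t + (e - 1)) *\<^sub>R u"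
      by (simp add: z_def algebra_simps)
    then have "t + (e - 1) \<in> L" using e t by (intro in_L) (auto simp: L_def)
    then show False using t e by force
  qed
  moreover have "a \<bullet> z \<le> a \<bullet> x"
    using t u by (simp add: z_def inner_add_right L_def mult_nonneg_nonpos)
  ultimately show ?thesis using zF that by blast
qed

text \<open>Linear programming inside a complex.  Every value on a cell other than a vertex is matched or undercut on a proper subcell, so
by induction at a vertex, and there are only finitely many vertices to compare.\<close>
lemma minimum_at_vertex:
  fixes a :: "'a::euclidean_space"
  assumes C: "cell_complex C" and "F \<in> C" "\<And>x. x \<in> F \<Longrightarrow> m \<le> a \<bullet> x"
    and gen: "\<And>F. F \<in> C \<Longrightarrow> (\<forall>x\<in>F. \<forall>y\<in>F. a \<bullet> x = a \<bullet> y) \<Longrightarrow> \<exists>v. F = {v}"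
  shows "\<exists>v. {v} \<in> C \<and> v \<in> F \<and> (\<forall>x\<in>F. a \<bullet> v \<le> a \<bullet> x)"
  using assms(2,3)
proof (induction "card {G \<in> C. G \<subseteq> F}" arbitrary: F rule: less_induct)
  case less
  show ?case
  proof (cases "\<forall>x\<in>F. \<forall>y\<in>F. a \<bullet> x = a \<bullet> y")
    case True
    then show ?thesis using gen less.prems by blast
  next
    case False
    then obtain p q where pq: "p \<in> F" "q \<in> F" "a \<bullet> p < a \<bullet> q"
      by (metis linorder_neqE_linordered_idom)
    have below: "\<exists>w. {w} \<in> C \<and> w \<in> F \<and> a \<bullet> w \<le> a \<bullet> x" if x: "x \<in> F" for x
    proof -
      obtain z where z: "z \<in> F" "z \<notin> rel_interior F" "a \<bullet> z \<le> a \<bullet> x"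
        using descend_to_boundary[OF cell_complexD(4,5)[OF C less.prems(1)] x less.prems(2) pq]
        by blast
      then obtain G where G: "G \<in> C" "G \<subset> F" "z \<in> G"
        using cell_complex_boundary[OF C less.prems(1)] by blast
      have "card {H \<in> C. H \<subseteq> G} < card {H \<in> C. H \<subseteq> F}"
        using G less.prems cell_complexD(1)[OF C] by (intro psubset_card_mono) auto
      then obtain w where "{w} \<in> C" "w \<in> G" "\<forall>x\<in>G. a \<bullet> w \<le> a \<bullet> x"
        using less.hyps[of G] less.prems G by blast
      then show ?thesis using G z by force
    qed
    let ?W = "{w. {w} \<in> C \<and> w \<in> F}"
    have W: "finite ?W" "?W \<noteq> {}"
      using finite_vertices[OF C] below[OF pq(1)] by (auto intro: rev_finite_subset)
    define v where "v = arg_min_on ((\<bullet>) a) ?W"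
    have v: "v \<in> ?W" unfolding v_def using W by (rule arg_min_if_finite(1))
    have "\<not> (\<exists>w\<in>?W. a \<bullet> w < a \<bullet> v)" unfolding v_def using W by (rule arg_min_if_finite(2))
    then have least: "a \<bullet> v \<le> a \<bullet> w" if "{w} \<in> C" "w \<in> F" for w using that by force
    have "a \<bullet> v \<le> a \<bullet> x" if x: "x \<in> F" for x
    proof -
      obtain w where "{w} \<in> C" "w \<in> F" "a \<bullet> w \<le> a \<bullet> x" using below[OF x] by blast
      then show ?thesis using least[of w] by simp
    qed
    then show ?thesis using v by blast
  qed
qed

section \<open>Tangent cones\<close>

text \<open>For a convex \<open>S\<close> that contains \<open>v\<close>, this is the cone with apex \<open>v\<close> spanned by \<open>S\<close>.  No closure is taken; for
polyhedra the result is closed all the same.\<close>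
definition tangent_cone :: "'a::real_vector \<Rightarrow> 'a set \<Rightarrow> 'a set" where
  "tangent_cone v S = {y. \<exists>s>0. v + s *\<^sub>R (y - v) \<in> S}"

lemma tangent_cone_mono: "S \<subseteq> T \<Longrightarrow> tangent_cone v S \<subseteq> tangent_cone v T"
  by (auto simp: tangent_cone_def)

lemma subset_tangent_cone: "S \<subseteq> tangent_cone v S"
proof
  fix x assume "x \<in> S"
  then show "x \<in> tangent_cone v S"
    unfolding tangent_cone_def by (intro CollectI exI[of _ 1]) simp
qed

lemma tangent_cone_iff: "y \<in> tangent_cone v S \<longleftrightarrow> (\<exists>s>0. v + s *\<^sub>R (y - v) \<in> S)"
  by (simp add: tangent_cone_def)

lemma tangent_cone_scale: "y \<in> tangent_cone v S \<Longrightarrow> 0 < r \<Longrightarrow> v + r *\<^sub>R (y - v) \<in> tangent_cone v S"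
proof -
  assume "y \<in> tangent_cone v S" and r: "0 < r"
  then obtain s where s: "s > 0" "v + s *\<^sub>R (y - v) \<in> S" by (auto simp: tangent_cone_iff)
  then have "v + (s / r) *\<^sub>R (v + r *\<^sub>R (y - v) - v) \<in> S" using r by simp
  then show ?thesis using s r unfolding tangent_cone_iff by (intro exI[of _ "s / r"]) simp
qed

lemma shrink_towards:
  assumes "convex S" "v \<in> S" "v + s *\<^sub>R w \<in> S" "0 \<le> r" "r \<le> s"
  shows "v + r *\<^sub>R w \<in> S"
proof (cases "s = 0")
  case False
  then have s: "s > 0" using assms by simp
  have "(1 - r / s) *\<^sub>R v + (r / s) *\<^sub>R (v + s *\<^sub>R w) \<in> S"
    using assms s by (intro convexD) auto
  also have "(1 - r / s) *\<^sub>R v + (r / s) *\<^sub>R (v + s *\<^sub>R w) = v + r *\<^sub>R w"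
    using s by (simp add: algebra_simps)
  finally show ?thesis .
qed (use assms in auto)

lemma convex_tangent_cone:
  assumes "convex S" "v \<in> S"
  shows "convex (tangent_cone v S)"
proof (rule convexI)
  fix x y :: 'a and u w :: real
  assume "x \<in> tangent_cone v S" "y \<in> tangent_cone v S" and uw: "0 \<le> u" "0 \<le> w" "u + w = 1"
  then obtain s t where st: "s > 0" "v + s *\<^sub>R (x - v) \<in> S" "t > 0" "v + t *\<^sub>R (y - v) \<in> S"
    by (auto simp: tangent_cone_iff)
  define r where "r = min s t"
  have r: "r > 0" "v + r *\<^sub>R (x - v) \<in> S" "v + r *\<^sub>R (y - v) \<in> S"
    using st shrink_towards[OF assms st(2), of r] shrink_towards[OF assms st(4), of r]
    by (simp_all add: r_def)
  have "u *\<^sub>R (v + r *\<^sub>R (x - v)) + w *\<^sub>R (v + r *\<^sub>R (y - v)) \<in> S"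
    by (rule convexD[OF assms(1) r(2,3) uw])
  also have "u *\<^sub>R (v + r *\<^sub>R (x - v)) + w *\<^sub>R (v + r *\<^sub>R (y - v))
      = (u + w) *\<^sub>R v + r *\<^sub>R (u *\<^sub>R x + w *\<^sub>R y - (u + w) *\<^sub>R v)"
    by (simp add: algebra_simps)
  finally show "u *\<^sub>R x + w *\<^sub>R y \<in> tangent_cone v S"
    using r uw by (auto simp: tangent_cone_iff)
qed

lemma tangent_cone_Int:
  assumes "convex S" "convex T" "v \<in> S" "v \<in> T"
  shows "tangent_cone v (S \<inter> T) = tangent_cone v S \<inter> tangent_cone v T"
proof (intro equalityI subsetI)
  fix y assume "y \<in> tangent_cone v S \<inter> tangent_cone v T"
  then obtain s t where st: "s > 0" "v + s *\<^sub>R (y - v) \<in> S" "t > 0" "v + t *\<^sub>R (y - v) \<in> T"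
    by (auto simp: tangent_cone_iff)
  have "v + min s t *\<^sub>R (y - v) \<in> S \<inter> T"
    using st shrink_towards[OF assms(1,3) st(2), of "min s t"]
      shrink_towards[OF assms(2,4) st(4), of "min s t"] by simp
  then show "y \<in> tangent_cone v (S \<inter> T)"
    using st unfolding tangent_cone_iff by (intro exI[of _ "min s t"]) auto
qed (auto simp: tangent_cone_iff)

lemma polyhedron_tangent_cone_halfspace:
  fixes a :: "'a::euclidean_space"
  assumes "a \<bullet> v \<le> b"
  shows "polyhedron (tangent_cone v {x. a \<bullet> x \<le> b})"
proof (cases "a \<bullet> v = b")
  case True
  have "tangent_cone v {x. a \<bullet> x \<le> b} = {x. a \<bullet> x \<le> b}"
  proof (intro equalityI subsetI)
    fix y assume "y \<in> tangent_cone v {x. a \<bullet> x \<le> b}"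
    then obtain s where "s > 0" "a \<bullet> (v + s *\<^sub>R (y - v)) \<le> b" by (auto simp: tangent_cone_iff)
    then have "s * (a \<bullet> y - b) \<le> 0"
      using True by (simp add: inner_add_right inner_diff_right)
    then show "y \<in> {x. a \<bullet> x \<le> b}" using \<open>s > 0\<close> by (simp add: mult_le_0_iff)
  qed (use subset_tangent_cone[of "{x. a \<bullet> x \<le> b}" v] in blast)
  then show ?thesis by (simp add: polyhedron_halfspace_le)
next
  case False
  have "y \<in> tangent_cone v {x. a \<bullet> x \<le> b}" for y
  proof -
    \<comment> \<open>Any positive \<open>c \<ge> a \<bullet> (y - v)\<close> would do; the summand 1 keeps it positive.\<close>
    define c where "c = \<bar>a \<bullet> (y - v)\<bar> + 1"
    define s where "s = (b - a \<bullet> v) / c"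
    have c: "c > 0" "a \<bullet> (y - v) \<le> c" by (auto simp: c_def)
    have s: "s > 0" using assms False c by (simp add: s_def)
    have "s * (a \<bullet> (y - v)) \<le> s * c" using s c by (intro mult_left_mono) auto
    also have "s * c = b - a \<bullet> v" using c by (simp add: s_def)
    finally have "a \<bullet> (v + s *\<^sub>R (y - v)) \<le> b" by (simp add: inner_add_right)
    then show ?thesis using s by (auto simp: tangent_cone_iff)
  qed
  then have "tangent_cone v {x. a \<bullet> x \<le> b} = UNIV" by blast
  then show ?thesis by simp
qed

text \<open>Taking tangent cones commutes with intersections, so only the half-spaces that define \<open>F\<close> matter.  Those
with \<open>v\<close> on the boundary are kept, and the others become the whole space.\<close>
lemma polyhedron_tangent_cone:
  fixes F :: "'a::euclidean_space set"
  assumes "polyhedron F" "v \<in> F"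
  shows "polyhedron (tangent_cone v F)"
proof -
  obtain H where H: "finite H" "F = \<Inter>H" "\<forall>h\<in>H. \<exists>a b. a \<noteq> 0 \<and> h = {x. a \<bullet> x \<le> b}"
    using assms(1) unfolding polyhedron_def by blast
  have "polyhedron (tangent_cone v (\<Inter>H))"
    using H(1) H(3) assms(2)[unfolded H(2)]
  proof (induction H rule: finite_induct)
    case empty
    have "tangent_cone v UNIV = UNIV" by (simp add: tangent_cone_def gt_ex)
    then show ?case by simp
  next
    case (insert h H)
    then obtain a b where h: "h = {x. a \<bullet> x \<le> b}" by blast
    have v: "v \<in> h" "v \<in> \<Inter>H" using insert.prems by auto
    have "convex h" unfolding h by (rule convex_halfspace_le)
    moreover have "convex k" if "k \<in> H" for k
    proof -
      have "\<exists>a b. a \<noteq> 0 \<and> k = {x. a \<bullet> x \<le> b}"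
        using that by (intro bspec[OF insert.prems(1)] insertI2)
      then show ?thesis by (auto simp: convex_halfspace_le)
    qed
    then have "convex (\<Inter>H)" by (rule convex_Inter)
    ultimately have "tangent_cone v (\<Inter>(insert h H)) = tangent_cone v h \<inter> tangent_cone v (\<Inter>H)"
      using v by (simp add: tangent_cone_Int)
    moreover have "polyhedron (tangent_cone v h)"
      using v(1) unfolding h by (intro polyhedron_tangent_cone_halfspace) simp
    moreover have "polyhedron (tangent_cone v (\<Inter>H))"
      using insert.IH insert.prems by simp
    ultimately show ?case by simp
  qed
  then show ?thesis using H(2) by simp
qed

lemma tangent_cone_subset_affine_hull:
  assumes "v \<in> S"
  shows "tangent_cone v S \<subseteq> affine hull S"
proof
  fix y assume "y \<in> tangent_cone v S"
  then obtain s where s: "s > 0" "v + s *\<^sub>R (y - v) \<in> S" by (auto simp: tangent_cone_iff)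
  let ?z = "v + s *\<^sub>R (y - v)"
  have "v + (1 / s) *\<^sub>R (?z - v) \<in> affine hull S"
    using s(2) assms by (intro mem_affine_3_minus[of "affine hull S" v ?z v "1 / s"] affine_affine_hull hull_inc)
  moreover have "v + (1 / s) *\<^sub>R (?z - v) = y" using s by simp
  ultimately show "y \<in> affine hull S" by metis
qed

text \<open>A relative interior point is one that every segment of the set ending there can be prolonged beyond.  For
points of the cone this can be tested after shrinking towards \<open>v\<close>, where the cone and \<open>F\<close> share the
segments in question.\<close>
lemma rel_interior_tangent_cone:
  fixes F :: "'a::euclidean_space set"
  assumes F: "convex F" "v \<in> F"
  shows "rel_interior (tangent_cone v F) = tangent_cone v (rel_interior F)"
proof (intro equalityI subsetI)
  have T: "convex (tangent_cone v F)" "tangent_cone v F \<noteq> {}"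
    using convex_tangent_cone[OF F] subset_tangent_cone[of F v] F by auto
  have shrink: "v + r *\<^sub>R w \<in> rel_interior F"
    if "v + s *\<^sub>R w \<in> rel_interior F" "0 < r" "r \<le> s" for r s w
  proof -
    have "(1 - r / s) *\<^sub>R v + (r / s) *\<^sub>R (v + s *\<^sub>R w) \<in> rel_interior F"
      using F that by (intro rel_interior_segment) auto
    also have "(1 - r / s) *\<^sub>R v + (r / s) *\<^sub>R (v + s *\<^sub>R w) = v + r *\<^sub>R w"
      using that by (simp add: algebra_simps)
    finally show ?thesis .
  qed
  {
    fix y assume y: "y \<in> rel_interior (tangent_cone v F)"
    obtain x where x: "x \<in> rel_interior F" using F rel_interior_eq_empty[OF F(1)] by blast
    then have "x \<in> tangent_cone v F" using rel_interior_subset[of F] subset_tangent_cone[of F v] by blast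
    then obtain e where e: "e > 1" "(1 - e) *\<^sub>R x + e *\<^sub>R y \<in> tangent_cone v F"
      using y convex_rel_interior_iff[OF T] by blast
    define z where "z = (1 - e) *\<^sub>R x + e *\<^sub>R y"
    obtain s where s: "s > 0" "v + s *\<^sub>R (z - v) \<in> F"
      using e by (auto simp: tangent_cone_iff z_def)
    define r where "r = min s 1"
    have r: "r > 0" "v + r *\<^sub>R (z - v) \<in> F"
      using s shrink_towards[OF F s(2), of r] by (simp_all add: r_def)
    have xr: "v + r *\<^sub>R (x - v) \<in> rel_interior F"
      using x r shrink[of 1 "x - v" r] by (simp add: r_def)
    have "(1 - (1 - 1 / e)) *\<^sub>R (v + r *\<^sub>R (z - v)) + (1 - 1 / e) *\<^sub>R (v + r *\<^sub>R (x - v)) \<in> rel_interior F"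
      using F r xr e by (intro rel_interior_segment) auto
    also have "(1 - (1 - 1 / e)) *\<^sub>R (v + r *\<^sub>R (z - v)) + (1 - 1 / e) *\<^sub>R (v + r *\<^sub>R (x - v))
        = v + r *\<^sub>R (y - v)"
    proof -
      have y: "y = (1 / e) *\<^sub>R z + (1 - 1 / e) *\<^sub>R x"
        using e by (simp add: z_def algebra_simps)
      show ?thesis unfolding y by (simp add: algebra_simps)
    qed
    finally show "y \<in> tangent_cone v (rel_interior F)"
      using r by (auto simp: tangent_cone_iff)
  next
    fix y assume "y \<in> tangent_cone v (rel_interior F)"
    then obtain s where s: "s > 0" "v + s *\<^sub>R (y - v) \<in> rel_interior F"
      by (auto simp: tangent_cone_iff)
    have "\<exists>e>1. (1 - e) *\<^sub>R x + e *\<^sub>R y \<in> tangent_cone v F" if "x \<in> tangent_cone v F" for x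
    proof -
      obtain t where t: "t > 0" "v + t *\<^sub>R (x - v) \<in> F" using \<open>x \<in> tangent_cone v F\<close> by (auto simp: tangent_cone_iff)
      define r where "r = min s t"
      have r: "r > 0" "v + r *\<^sub>R (x - v) \<in> F" "v + r *\<^sub>R (y - v) \<in> rel_interior F"
        using s t shrink_towards[OF F t(2), of r] shrink[OF s(2), of r] by (simp_all add: r_def)
      then obtain e where e: "e > 1"
        "(1 - e) *\<^sub>R (v + r *\<^sub>R (x - v)) + e *\<^sub>R (v + r *\<^sub>R (y - v)) \<in> F"
        using convex_rel_interior_iff[OF F(1)] F(2) by blast
      have "(1 - e) *\<^sub>R (v + r *\<^sub>R (x - v)) + e *\<^sub>R (v + r *\<^sub>R (y - v))
          = v + r *\<^sub>R ((1 - e) *\<^sub>R x + e *\<^sub>R y - v)"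
        by (simp add: algebra_simps)
      then show ?thesis using e r by (auto simp: tangent_cone_iff)
    qed
    then show "y \<in> rel_interior (tangent_cone v F)"
      using convex_rel_interior_iff[OF T] by blast
  }
qed

section \<open>Slices and tangent complexes\<close>

text \<open>A cell that crosses the hyperplane meets it in its relative interior.  Hence the relative interior of a
slice is the slice of the relative interior, and both conditions on a complex, as well as the order of
the cells, can be read off before slicing.\<close>
lemma cell_complex_slice:
  fixes C :: "'a::euclidean_space set set" and a :: 'a
  assumes C: "cell_complex C"
    and cross: "\<And>F. F \<in> C \<Longrightarrow> F \<inter> {x. a \<bullet> x = s} \<noteq> {} \<Longrightarrow> (\<exists>x\<in>F. a \<bullet> x < s) \<and> (\<exists>y\<in>F. s < a \<bullet> y)"
  defines "H \<equiv> {x. a \<bullet> x = s}"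
  defines "Q \<equiv> {F \<in> C. F \<inter> H \<noteq> {}}"
  shows "cell_complex ((\<lambda>F. F \<inter> H) ` Q)"
    and "\<And>F G. F \<in> Q \<Longrightarrow> G \<in> Q \<Longrightarrow> F \<inter> H \<subseteq> G \<inter> H \<longleftrightarrow> F \<subseteq> G"
proof -
  have H: "affine H" "polyhedron H"
    unfolding H_def by (rule affine_hyperplane polyhedron_hyperplane)+
  have ri: "\<exists>z. z \<in> rel_interior F \<and> z \<in> H" if F: "F \<in> Q" for F
  proof -
    have "F \<in> C" "F \<inter> {x. a \<bullet> x = s} \<noteq> {}" using F by (auto simp: Q_def H_def)
    then obtain x y where "x \<in> F" "a \<bullet> x < s" "y \<in> F" "s < a \<bullet> y" using cross by blast
    with cell_complexD(4)[OF C \<open>F \<in> C\<close>] obtain z where "z \<in> rel_interior F" "a \<bullet> z = s"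
      by (rule rel_interior_meets_hyperplane)
    then show ?thesis by (auto simp: H_def)
  qed
  have QC: "F \<in> C" if "F \<in> Q" for F using that by (simp add: Q_def)
  have rel: "rel_interior (F \<inter> H) = rel_interior F \<inter> H" if "F \<in> Q" for F
    using ri[OF that] by (intro convex_affine_rel_interior_Int cell_complexD(4)[OF C QC[OF that]] H(1)) blast
  show embed: "F \<inter> H \<subseteq> G \<inter> H \<longleftrightarrow> F \<subseteq> G" if F: "F \<in> Q" and G: "G \<in> Q" for F G
  proof
    assume sub: "F \<inter> H \<subseteq> G \<inter> H"
    obtain z where z: "z \<in> rel_interior F" "z \<in> H" using ri[OF F] by blast
    then have "z \<in> G" using sub rel_interior_subset by blast
    with z show "F \<subseteq> G" using cell_complexD(6)[OF C QC[OF F] QC[OF G]] by blast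
  qed blast
  show "cell_complex ((\<lambda>F. F \<inter> H) ` Q)"
    unfolding cell_complex_def ball_simps
  proof (intro conjI ballI impI)
    show "finite ((\<lambda>F. F \<inter> H) ` Q)"
      using cell_complexD(1)[OF C] by (simp add: Q_def)
  next
    fix F assume F: "F \<in> Q"
    show poly: "polyhedron (F \<inter> H)"
      using cell_complexD(2)[OF C QC[OF F]] H(2) by simp
    show "F \<inter> H \<noteq> {}" using F by (simp add: Q_def)
    show "rel_frontier (F \<inter> H) \<subseteq> \<Union>{G \<in> (\<lambda>F. F \<inter> H) ` Q. G \<subset> F \<inter> H}"
    proof
      fix x assume "x \<in> rel_frontier (F \<inter> H)"
      then have x: "x \<in> F" "x \<in> H" "x \<notin> rel_interior F"
        using polyhedron_imp_closed[OF poly] rel[OF F] by (auto simp: rel_frontier_def)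
      then obtain G where G: "G \<in> C" "G \<subset> F" "x \<in> G"
        using cell_complex_boundary[OF C QC[OF F]] by blast
      then have GQ: "G \<in> Q" using x by (auto simp: Q_def)
      have "G \<inter> H \<subset> F \<inter> H"
        using embed[OF F GQ] G(2) by blast
      then show "x \<in> \<Union>{G \<in> (\<lambda>F. F \<inter> H) ` Q. G \<subset> F \<inter> H}"
        using GQ G(3) x(2) by blast
    qed
  next
    fix F G assume F: "F \<in> Q" and G: "G \<in> Q" and ne: "rel_interior (F \<inter> H) \<inter> (G \<inter> H) \<noteq> {}"
    then obtain x where "x \<in> rel_interior F" "x \<in> G" unfolding rel[OF F] by blast
    then have "F \<subseteq> G" using cell_complexD(6)[OF C QC[OF F] QC[OF G]] by blast
    then show "F \<inter> H \<subseteq> G \<inter> H" by blast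
  qed
qed

text \<open>Near \<open>v\<close> only the cells through \<open>v\<close> are present, because the others are closed and finite in number.  So a
point of a tangent cone, shrunk far enough towards \<open>v\<close>, lies in the original complex, and every claim
about the cones is a claim about the original cells there.\<close>
lemma cell_complex_tangent_cones:
  fixes C :: "'a::euclidean_space set set"
  assumes C: "cell_complex C" and conv: "convex (\<Union>C)" and v: "v \<in> \<Union>C"
  defines "S \<equiv> {F \<in> C. v \<in> F}"
  shows "cell_complex (tangent_cone v ` S)"
    and "\<And>F G. F \<in> S \<Longrightarrow> G \<in> S \<Longrightarrow> tangent_cone v F \<subseteq> tangent_cone v G \<longleftrightarrow> F \<subseteq> G"
    and "\<Union>(tangent_cone v ` S) = tangent_cone v (\<Union>C)"
proof -
  have S: "F \<in> C" "v \<in> F" "convex F" "closed F" if "F \<in> S" for F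
    using that cell_complexD(4,5)[OF C] by (auto simp: S_def)
  have ball: "\<exists>e>0. \<forall>s w. 0 < s \<longrightarrow> s * norm w < e \<longrightarrow> (\<forall>F\<in>C. v + s *\<^sub>R w \<in> F \<longrightarrow> F \<in> S)"
  proof -
    have "closed (\<Union>(C - S))"
      using cell_complexD(1,5)[OF C] by (intro closed_Union) auto
    moreover have "v \<notin> \<Union>(C - S)" by (auto simp: S_def)
    ultimately obtain e where e: "e > 0" "ball v e \<inter> \<Union>(C - S) = {}"
      by (metis Compl_iff disjoint_eq_subset_Compl open_Compl open_contains_ball)
    have "F \<in> S" if "0 < s" "s * norm w < e" "F \<in> C" "v + s *\<^sub>R w \<in> F" for s w F
    proof -
      have "v + s *\<^sub>R w \<in> ball v e" using that by (simp add: dist_norm)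
      then show ?thesis using that e by blast
    qed
    then show ?thesis using e(1) by blast
  qed
  then obtain e where e: "e > 0"
    "\<And>s w F. 0 < s \<Longrightarrow> s * norm w < e \<Longrightarrow> F \<in> C \<Longrightarrow> v + s *\<^sub>R w \<in> F \<Longrightarrow> F \<in> S" by blast
  \<comment> \<open>Brings \<open>v + r *\<^sub>R w\<close> so close to \<open>v\<close> that only cells through \<open>v\<close> can contain it.\<close>
  have small: "\<exists>r. 0 < r \<and> r \<le> s \<and> r * norm w < e" if "s > 0" for s :: real and w :: 'a
  proof -
    define r where "r = min s (e / (norm w + 1))"
    have n: "0 < norm w + 1" by (simp add: add_nonneg_pos)
    have r: "0 < r" "r \<le> s" using that e n by (auto simp: r_def)
    have "r * norm w < r * (norm w + 1)" using r by simp
    also have "\<dots> \<le> e / (norm w + 1) * (norm w + 1)"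
      using n by (intro mult_right_mono) (auto simp: r_def)
    also have "\<dots> = e" using n by simp
    finally show ?thesis using r by blast
  qed
  have scaled: "F \<subseteq> G"
    if F: "F \<in> S" and G: "G \<in> S" and x: "x \<in> tangent_cone v (rel_interior F)" "x \<in> tangent_cone v G" for F G x
  proof -
    obtain s where s: "s > 0" "v + s *\<^sub>R (x - v) \<in> rel_interior F" using x by (auto simp: tangent_cone_iff)
    obtain t where t: "t > 0" "v + t *\<^sub>R (x - v) \<in> G" using x by (auto simp: tangent_cone_iff)
    define r where "r = min s t"
    have r: "0 < r" "r \<le> s" "r \<le> t" using s t by (auto simp: r_def)
    have "v + r *\<^sub>R (x - v) \<in> G"
      using shrink_towards[OF S(3,2)[OF G] t(2)] r by simp
    moreover have "(1 - r / s) *\<^sub>R v + (r / s) *\<^sub>R (v + s *\<^sub>R (x - v)) \<in> rel_interior F"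
      using S[OF F] s r by (intro rel_interior_segment) auto
    then have "v + r *\<^sub>R (x - v) \<in> rel_interior F"
      using s by (simp add: algebra_simps)
    ultimately show "F \<subseteq> G" using cell_complexD(6)[OF C S(1)[OF F] S(1)[OF G]] by blast
  qed
  show embed: "tangent_cone v F \<subseteq> tangent_cone v G \<longleftrightarrow> F \<subseteq> G" if F: "F \<in> S" and G: "G \<in> S" for F G
  proof
    assume sub: "tangent_cone v F \<subseteq> tangent_cone v G"
    obtain x where x: "x \<in> rel_interior F"
      using rel_interior_eq_empty[OF S(3)[OF F]] S(2)[OF F] by blast
    then have "x \<in> tangent_cone v (rel_interior F)" using subset_tangent_cone by blast
    moreover have "x \<in> tangent_cone v F"
      using x rel_interior_subset[of F] subset_tangent_cone[of F v] by blast
    ultimately show "F \<subseteq> G" using scaled[OF F G] sub by blast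
  qed (rule tangent_cone_mono)
  show "cell_complex (tangent_cone v ` S)"
    unfolding cell_complex_def ball_simps
  proof (intro conjI ballI impI)
    show "finite (tangent_cone v ` S)"
      using cell_complexD(1)[OF C] by (simp add: S_def)
  next
    fix F assume F: "F \<in> S"
    show poly: "polyhedron (tangent_cone v F)"
      using cell_complexD(2)[OF C S(1)[OF F]] S(2)[OF F] by (rule polyhedron_tangent_cone)
    show "tangent_cone v F \<noteq> {}"
      using S(2)[OF F] subset_tangent_cone[of F v] by blast
    show "rel_frontier (tangent_cone v F) \<subseteq> \<Union>{G \<in> tangent_cone v ` S. G \<subset> tangent_cone v F}"
    proof
      fix x assume "x \<in> rel_frontier (tangent_cone v F)"
      then have x: "x \<in> tangent_cone v F" "x \<notin> tangent_cone v (rel_interior F)"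
        using polyhedron_imp_closed[OF poly] rel_interior_tangent_cone[OF S(3,2)[OF F]]
        by (auto simp: rel_frontier_def)
      then obtain s where s: "s > 0" "v + s *\<^sub>R (x - v) \<in> F" by (auto simp: tangent_cone_iff)
      obtain r where r: "0 < r" "r \<le> s" "r * norm (x - v) < e" using small[OF s(1)] by blast
      have "v + r *\<^sub>R (x - v) \<in> F"
        using shrink_towards[OF S(3,2)[OF F] s(2)] r by simp
      moreover have "v + r *\<^sub>R (x - v) \<notin> rel_interior F"
        using x(2) r by (auto simp: tangent_cone_iff)
      ultimately obtain G where G: "G \<in> C" "G \<subset> F" "v + r *\<^sub>R (x - v) \<in> G"
        using cell_complex_boundary[OF C S(1)[OF F]] by blast
      then have GS: "G \<in> S" using e(2) r by blast
      have "tangent_cone v G \<subset> tangent_cone v F"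
        using embed[OF F GS] embed[OF GS F] G(2) by blast
      moreover have "x \<in> tangent_cone v G" using G r by (auto simp: tangent_cone_iff)
      ultimately show "x \<in> \<Union>{G \<in> tangent_cone v ` S. G \<subset> tangent_cone v F}"
        using GS by blast
    qed
  next
    fix F G assume F: "F \<in> S" and G: "G \<in> S"
      and ne: "rel_interior (tangent_cone v F) \<inter> tangent_cone v G \<noteq> {}"
    then obtain x where "x \<in> tangent_cone v (rel_interior F)" "x \<in> tangent_cone v G"
      unfolding rel_interior_tangent_cone[OF S(3,2)[OF F]] by blast
    then show "tangent_cone v F \<subseteq> tangent_cone v G"
      by (intro tangent_cone_mono scaled[OF F G])
  qed
  show "\<Union>(tangent_cone v ` S) = tangent_cone v (\<Union>C)"
  proof (intro equalityI subsetI)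
    fix x assume "x \<in> tangent_cone v (\<Union>C)"
    then obtain s where s: "s > 0" "v + s *\<^sub>R (x - v) \<in> \<Union>C" by (auto simp: tangent_cone_iff)
    obtain r where r: "0 < r" "r \<le> s" "r * norm (x - v) < e" using small[OF s(1)] by blast
    have "v + r *\<^sub>R (x - v) \<in> \<Union>C"
      using shrink_towards[OF conv v s(2)] r by simp
    then obtain F where F: "F \<in> C" "v + r *\<^sub>R (x - v) \<in> F" by blast
    then have "F \<in> S" using e(2) r by blast
    moreover have "x \<in> tangent_cone v F" using F r by (auto simp: tangent_cone_iff)
    ultimately show "x \<in> \<Union>(tangent_cone v ` S)" by blast
  next
    fix x assume "x \<in> \<Union>(tangent_cone v ` S)"
    then obtain F where "F \<in> C" "x \<in> tangent_cone v F" using S(1) by blast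
    then show "x \<in> tangent_cone v (\<Union>C)"
      using tangent_cone_mono[of F "\<Union>C" v] by blast
  qed
qed

section \<open>Sweeping a convex cell complex\<close>

text \<open>Slicing lowers the dimension, and the order of the cells that are hit is that of their slices.\<close>
lemma nonevasive_slice:
  fixes C :: "'a::euclidean_space set set" and a :: 'a
  assumes C: "cell_complex C" and conv: "convex (\<Union>C)"
    and cross: "\<And>F. F \<in> C \<Longrightarrow> F \<inter> {x. a \<bullet> x = s} \<noteq> {} \<Longrightarrow> (\<exists>x\<in>F. a \<bullet> x < s) \<and> (\<exists>y\<in>F. s < a \<bullet> y)"
    and ne: "{F \<in> C. F \<inter> {x. a \<bullet> x = s} \<noteq> {}} \<noteq> {}"
    and IH: "\<And>C' :: 'a set set. cell_complex C' \<Longrightarrow> C' \<noteq> {} \<Longrightarrow> convex (\<Union>C') \<Longrightarrow>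
        aff_dim (\<Union>C') < aff_dim (\<Union>C) \<Longrightarrow> nonevasive C'"
  shows "nonevasive {F \<in> C. F \<inter> {x. a \<bullet> x = s} \<noteq> {}}" (is "nonevasive ?Q")
proof -
  let ?H = "{x. a \<bullet> x = s}"
  let ?h = "\<lambda>F. F \<inter> ?H"
  have U: "\<Union>(?h ` ?Q) = \<Union>C \<inter> ?H" by blast
  obtain F where F: "F \<in> C" "F \<inter> ?H \<noteq> {}" using ne by blast
  then obtain y where y: "y \<in> F" "s < a \<bullet> y" using cross by blast
  have "y \<in> affine hull \<Union>C" using y(1) F(1) by (intro hull_inc) blast
  then have off: "\<not> affine hull \<Union>C \<subseteq> ?H" using y(2) by auto
  have "\<Union>C \<noteq> {}" using F(1) y(1) by blast
  then have "0 \<le> aff_dim (\<Union>C)" using aff_dim_negative_iff[of "\<Union>C"] by linarith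
  have "aff_dim (\<Union>C \<inter> ?H) \<le> aff_dim (affine hull \<Union>C \<inter> ?H)"
    by (intro aff_dim_subset Int_mono hull_subset order_refl)
  also have "\<dots> < aff_dim (\<Union>C)"
    using off \<open>0 \<le> aff_dim (\<Union>C)\<close> by (simp add: aff_dim_affine_Int_hyperplane)
  finally have dim: "aff_dim (\<Union>(?h ` ?Q)) < aff_dim (\<Union>C)" unfolding U .
  have "nonevasive (?h ` ?Q)"
  proof (rule IH[OF _ _ _ dim])
    show "cell_complex (?h ` ?Q)" using C cross by (rule cell_complex_slice(1))
    show "?h ` ?Q \<noteq> {}" using ne by blast
    show "convex (\<Union>(?h ` ?Q))"
      unfolding U using conv convex_hyperplane by (rule convex_Int)
  qed
  then show ?thesis
    by (rule nonevasive_order_embedding) (rule cell_complex_slice(2)[OF C cross])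
qed

text \<open>The cells through \<open>v\<close> that reach below \<open>v\<close> are those whose tangent cones meet the hyperplane one unit below
\<open>v\<close>.  The tangent cones cover the convex tangent cone of the whole complex, so this is again a convex
slice of lower dimension; the point \<open>z\<close> ensures that it is not empty.\<close>
lemma nonevasive_descending_link:
  fixes C :: "'a::euclidean_space set set" and a :: 'a
  assumes C: "cell_complex C" and conv: "convex (\<Union>C)" and v: "v \<in> \<Union>C"
    and below: "z \<in> \<Union>C" "a \<bullet> z < a \<bullet> v"
    and IH: "\<And>C' :: 'a set set. cell_complex C' \<Longrightarrow> C' \<noteq> {} \<Longrightarrow> convex (\<Union>C') \<Longrightarrow>
        aff_dim (\<Union>C') < aff_dim (\<Union>C) \<Longrightarrow> nonevasive C'"
  shows "nonevasive {F \<in> C. v \<in> F \<and> (\<exists>x\<in>F. a \<bullet> x < a \<bullet> v)}" (is "nonevasive ?L")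
proof -
  let ?S = "{F \<in> C. v \<in> F}"
  let ?T = "tangent_cone v"
  let ?H = "{x. a \<bullet> x = a \<bullet> v - 1}"
  have T: "cell_complex (?T ` ?S)"
    "\<And>F G. F \<in> ?S \<Longrightarrow> G \<in> ?S \<Longrightarrow> ?T F \<subseteq> ?T G \<longleftrightarrow> F \<subseteq> G"
    "\<Union>(?T ` ?S) = ?T (\<Union>C)"
    using cell_complex_tangent_cones[OF C conv v] by blast+
  have meets: "?T F \<inter> ?H \<noteq> {} \<longleftrightarrow> (\<exists>x\<in>?T F. a \<bullet> x < a \<bullet> v)" for F
  proof
    assume "\<exists>x\<in>?T F. a \<bullet> x < a \<bullet> v"
    then obtain x where x: "x \<in> ?T F" "a \<bullet> (x - v) < 0" by (auto simp: inner_diff_right)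
    \<comment> \<open>The scaling towards or away from \<open>v\<close> that brings \<open>x\<close> exactly one unit below \<open>v\<close>.\<close>
    define r where "r = - 1 / (a \<bullet> (x - v))"
    have "r > 0" using x(2) by (simp add: r_def)
    then have "v + r *\<^sub>R (x - v) \<in> ?T F" using x(1) tangent_cone_scale by blast
    moreover have "a \<bullet> (v + r *\<^sub>R (x - v)) = a \<bullet> v - 1"
      using x(2) by (simp only: inner_add_right inner_scaleR_right) (simp add: r_def)
    ultimately show "?T F \<inter> ?H \<noteq> {}" by blast
  next
    assume "?T F \<inter> ?H \<noteq> {}"
    then obtain x where "x \<in> ?T F" "a \<bullet> x = a \<bullet> v - 1" by blast
    moreover from this have "a \<bullet> x < a \<bullet> v" by linarith
    ultimately show "\<exists>x\<in>?T F. a \<bullet> x < a \<bullet> v" by blast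
  qed
  have descends: "(\<exists>x\<in>?T F. a \<bullet> x < a \<bullet> v) \<longleftrightarrow> (\<exists>x\<in>F. a \<bullet> x < a \<bullet> v)" for F
  proof
    assume "\<exists>x\<in>?T F. a \<bullet> x < a \<bullet> v"
    then obtain x s where x: "a \<bullet> x < a \<bullet> v" "s > 0" "v + s *\<^sub>R (x - v) \<in> F"
      by (auto simp: tangent_cone_iff)
    have "s * (a \<bullet> x - a \<bullet> v) < 0" using x by (intro mult_pos_neg) auto
    then have "a \<bullet> (v + s *\<^sub>R (x - v)) < a \<bullet> v"
      by (simp add: inner_add_right inner_diff_right)
    then show "\<exists>x\<in>F. a \<bullet> x < a \<bullet> v" using x(3) by blast
  qed (use subset_tangent_cone[of F v] in blast)
  have image: "?T ` ?L = {F \<in> ?T ` ?S. F \<inter> ?H \<noteq> {}}"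
  proof (intro equalityI subsetI)
    fix F assume "F \<in> ?T ` ?L"
    then obtain G where G: "F = ?T G" "G \<in> C" "v \<in> G" "\<exists>x\<in>G. a \<bullet> x < a \<bullet> v" by blast
    have "?T G \<inter> ?H \<noteq> {}" using G(4) by (simp only: meets descends)
    then show "F \<in> {F \<in> ?T ` ?S. F \<inter> ?H \<noteq> {}}" using G(1-3) by blast
  next
    fix F assume "F \<in> {F \<in> ?T ` ?S. F \<inter> ?H \<noteq> {}}"
    then obtain G where G: "F = ?T G" "G \<in> C" "v \<in> G" "?T G \<inter> ?H \<noteq> {}" by blast
    have "\<exists>x\<in>G. a \<bullet> x < a \<bullet> v" using G(4) by (simp only: meets descends)
    then show "F \<in> ?T ` ?L" using G(1-3) by blast
  qed
  have "nonevasive {F \<in> ?T ` ?S. F \<inter> ?H \<noteq> {}}"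
  proof (rule nonevasive_slice[OF T(1)])
    show "convex (\<Union>(?T ` ?S))"
      unfolding T(3) using conv v by (rule convex_tangent_cone)
    show "(\<exists>x\<in>F. a \<bullet> x < a \<bullet> v - 1) \<and> (\<exists>y\<in>F. a \<bullet> v - 1 < a \<bullet> y)"
      if "F \<in> ?T ` ?S" "F \<inter> ?H \<noteq> {}" for F
    proof -
      obtain G where G: "F = ?T G" "v \<in> G" using \<open>F \<in> ?T ` ?S\<close> by blast
      obtain x where x: "x \<in> F" "a \<bullet> x = a \<bullet> v - 1" using \<open>F \<inter> ?H \<noteq> {}\<close> by blast
      \<comment> \<open>Doubling the distance from the apex \<open>v\<close> leads from the hyperplane to its far side.\<close>
      have "v + 2 *\<^sub>R (x - v) \<in> F" using x(1) unfolding G(1) by (rule tangent_cone_scale) simp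
      moreover have "a \<bullet> (v + 2 *\<^sub>R (x - v)) < a \<bullet> v - 1"
        using x(2) by (simp add: inner_add_right inner_diff_right)
      moreover have "v \<in> F" using G subset_tangent_cone[of G v] by blast
      moreover have "a \<bullet> v - 1 < a \<bullet> v" by simp
      ultimately show ?thesis by blast
    qed
    show "{F \<in> ?T ` ?S. F \<inter> ?H \<noteq> {}} \<noteq> {}"
    proof -
      have "z \<in> ?T (\<Union>C)" using below(1) subset_tangent_cone by blast
      then obtain F where "F \<in> ?T ` ?S" "z \<in> F" unfolding T(3)[symmetric] by blast
      then have "F \<inter> ?H \<noteq> {}" using meets below(2) by blast
      with \<open>F \<in> ?T ` ?S\<close> show ?thesis by blast
    qed
    fix C' :: "'a set set"
    assume C': "cell_complex C'" "C' \<noteq> {}" "convex (\<Union>C')" "aff_dim (\<Union>C') < aff_dim (\<Union>(?T ` ?S))"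
    have "aff_dim (\<Union>(?T ` ?S)) \<le> aff_dim (\<Union>C)"
      unfolding T(3) using aff_dim_subset[OF tangent_cone_subset_affine_hull[OF v]] by simp
    with C' show "nonevasive C'" by (intro IH) auto
  qed
  then have "nonevasive (?T ` ?L)" unfolding image .
  then show ?thesis
    by (rule nonevasive_order_embedding) (rule T(2); blast)
qed

text \<open>The sweep.  If \<open>v\<close> is the highest vertex below level \<open>t\<close>, then the cells that reach below \<open>t\<close> but not below
\<open>v\<close> all have their minimum at \<open>v\<close>, by genericity only there, and in particular contain \<open>v\<close>.  Other than
\<open>{v}\<close> they have links that are cones with apex \<open>{v}\<close>; after their removal the link of \<open>{v}\<close> is its
descending link.  If no vertex lies below \<open>t\<close>, the cells in question are unbounded below, and a
hyperplane far enough down slices them all.\<close>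
lemma nonevasive_sublevel:
  fixes C :: "'a::euclidean_space set set" and a :: 'a
  assumes C: "cell_complex C" and conv: "convex (\<Union>C)"
    and inj: "\<And>v w. {v} \<in> C \<Longrightarrow> {w} \<in> C \<Longrightarrow> a \<bullet> v = a \<bullet> w \<Longrightarrow> v = w"
    and gen: "\<And>F. F \<in> C \<Longrightarrow> (\<forall>x\<in>F. \<forall>y\<in>F. a \<bullet> x = a \<bullet> y) \<Longrightarrow> \<exists>v. F = {v}"
    and IH: "\<And>C' :: 'a set set. cell_complex C' \<Longrightarrow> C' \<noteq> {} \<Longrightarrow> convex (\<Union>C') \<Longrightarrow>
        aff_dim (\<Union>C') < aff_dim (\<Union>C) \<Longrightarrow> nonevasive C'"
    and ne: "{F \<in> C. \<exists>x\<in>F. a \<bullet> x < t} \<noteq> {}"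
  shows "nonevasive {F \<in> C. \<exists>x\<in>F. a \<bullet> x < t}"
  using ne
proof (induction "card {v. {v} \<in> C \<and> a \<bullet> v < t}" arbitrary: t rule: less_induct)
  case less
  let ?Q = "\<lambda>t. {F \<in> C. \<exists>x\<in>F. a \<bullet> x < t}"
  let ?V = "\<lambda>t. {v. {v} \<in> C \<and> a \<bullet> v < t}"
  have finV: "finite (?V t)" for t
    using finite_vertices[OF C] by (rule rev_finite_subset) blast
  have finC: "finite C" by (rule cell_complexD(1)[OF C])
  have vertex: "\<exists>v. {v} \<in> C \<and> v \<in> F \<and> (\<forall>x\<in>F. a \<bullet> v \<le> a \<bullet> x)"
    if "F \<in> C" "\<And>x. x \<in> F \<Longrightarrow> m \<le> a \<bullet> x" for F m
    using minimum_at_vertex[OF C that gen] by blast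
  show ?case
  proof (cases "?V t = {}")
    case True
    have unbounded: "\<exists>x\<in>F. a \<bullet> x < m" if F: "F \<in> ?Q t" for F m
    proof (rule ccontr)
      assume "\<not> (\<exists>x\<in>F. a \<bullet> x < m)"
      then have "\<And>x. x \<in> F \<Longrightarrow> m \<le> a \<bullet> x" by force
      then obtain v where v: "{v} \<in> C" "\<forall>x\<in>F. a \<bullet> v \<le> a \<bullet> x" using F vertex[of F m] by blast
      obtain x where "x \<in> F" "a \<bullet> x < t" using F by blast
      then have "a \<bullet> v < t" using v(2) by force
      then show False using True v(1) by blast
    qed
    have "\<forall>F\<in>C. \<exists>p. p \<in> F" using cell_complexD(3)[OF C] by blast
    from bchoice[OF this] obtain p where p: "\<forall>F\<in>C. p F \<in> F" ..
    \<comment> \<open>Strictly below \<open>t\<close> and below some point of each cell, so that every cell hit by the slice is crossed.\<close>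
    define s where "s = Min (insert t ((\<lambda>F. a \<bullet> p F) ` C)) - 1"
    have s: "s < t" "\<And>F. F \<in> C \<Longrightarrow> s < a \<bullet> p F"
    proof -
      have fin: "finite (insert t ((\<lambda>F. a \<bullet> p F) ` C))" using finC by simp
      show "s < t" using Min_le[OF fin, of t] by (simp add: s_def)
      show "s < a \<bullet> p F" if "F \<in> C" for F
        using Min_le[OF fin, of "a \<bullet> p F"] that by (simp add: s_def)
    qed
    have eq: "?Q t = {F \<in> C. F \<inter> {x. a \<bullet> x = s} \<noteq> {}}"
    proof (intro equalityI subsetI)
      fix F assume F: "F \<in> ?Q t"
      then have FC: "F \<in> C" by blast
      obtain x where x: "x \<in> F" "a \<bullet> x < s" using unbounded[OF F] by blast
      have "\<exists>z\<in>F. a \<bullet> z = s"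
        using x(1) p FC x(2) s(2)[OF FC]
        by (intro connected_ivt_hyperplane[of F x "p F"] convex_connected cell_complexD(4)[OF C FC]) auto
      then show "F \<in> {F \<in> C. F \<inter> {x. a \<bullet> x = s} \<noteq> {}}" using FC by blast
    next
      fix F assume "F \<in> {F \<in> C. F \<inter> {x. a \<bullet> x = s} \<noteq> {}}"
      then show "F \<in> ?Q t" using s(1) by blast
    qed
    show ?thesis
      unfolding eq
    proof (rule nonevasive_slice[OF C conv _ _ IH])
      fix F assume F: "F \<in> C" "F \<inter> {x. a \<bullet> x = s} \<noteq> {}"
      then have "F \<in> ?Q t" unfolding eq by blast
      then show "(\<exists>x\<in>F. a \<bullet> x < s) \<and> (\<exists>y\<in>F. s < a \<bullet> y)"
        using unbounded s(2)[OF F(1)] p F(1) by blast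
    next
      show "{F \<in> C. F \<inter> {x. a \<bullet> x = s} \<noteq> {}} \<noteq> {}"
        using less.prems unfolding eq .
    qed
  next
    case False
    have "finite ((\<bullet>) a ` ?V t)" "(\<bullet>) a ` ?V t \<noteq> {}"
      using finV[of t] False by blast+
    then have "Max ((\<bullet>) a ` ?V t) \<in> (\<bullet>) a ` ?V t" by (rule Max_in)
    then obtain v where v: "Max ((\<bullet>) a ` ?V t) = a \<bullet> v" "v \<in> ?V t" by (rule imageE)
    have top: "a \<bullet> w \<le> a \<bullet> v" if "{w} \<in> C" "a \<bullet> w < t" for w
      unfolding v(1)[symmetric] using finV[of t] that by (intro Max_ge) auto
    have v: "{v} \<in> C" "a \<bullet> v < t" using v(2) by auto
    have upper: "v \<in> F" if F: "F \<in> ?Q t" "F \<notin> ?Q (a \<bullet> v)" for F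
    proof -
      have "a \<bullet> v \<le> a \<bullet> x" if "x \<in> F" for x using F that by force
      then obtain w where w: "{w} \<in> C" "w \<in> F" "\<forall>x\<in>F. a \<bullet> w \<le> a \<bullet> x"
        using F(1) vertex[of F "a \<bullet> v"] by blast
      obtain x where "x \<in> F" "a \<bullet> x < t" using F(1) by blast
      then have "a \<bullet> w < t" using w(3) by force
      then have "a \<bullet> w \<le> a \<bullet> v" using top w(1) by blast
      moreover have "a \<bullet> v \<le> a \<bullet> w" using F w(2) by force
      ultimately have "v = w" by (intro inj v(1) w(1) antisym)
      then show ?thesis using w(2) by simp
    qed
    have vQ: "{v} \<in> ?Q t" using v by auto
    have finQ: "finite (?Q t)" using finC by simp
    show ?thesis
    proof (cases "?Q (a \<bullet> v) = {}")
      case True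
      then have "F \<notin> ?Q (a \<bullet> v)" for F by (metis empty_iff)
      then have vF: "v \<in> F" if "F \<in> ?Q t" for F using upper[OF that] by metis
      show ?thesis
        using finQ vQ by (rule nonevasive_cone) (rule disjI2, simp only: insert_subset empty_subsetI vF)
    next
      case False
      have "?V (a \<bullet> v) \<subset> ?V t" using v by force
      then have "card (?V (a \<bullet> v)) < card (?V t)" by (rule psubset_card_mono[OF finV])
      then have lower: "nonevasive (?Q (a \<bullet> v))" using False by (rule less.hyps)
      \<comment> \<open>The cells other than \<open>{v}\<close> whose minimum is at \<open>v\<close>.\<close>
      define X where "X = ?Q t - ?Q (a \<bullet> v) - {{v}}"
      have X: "?Q t - X = insert {v} (?Q (a \<bullet> v))"
      proof -
        have diff: "A - (A - B - {e}) = insert e B" if "B \<subseteq> A" "e \<in> A" for A B :: "'a set set" and e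
          using that by blast
        have "?Q (a \<bullet> v) \<subseteq> ?Q t"
        proof
          fix F assume "F \<in> ?Q (a \<bullet> v)"
          then obtain x where x: "F \<in> C" "x \<in> F" "a \<bullet> x < a \<bullet> v" by blast
          then have "a \<bullet> x < t" using v(2) by simp
          with x show "F \<in> ?Q t" by blast
        qed
        from diff[OF this vQ] show ?thesis unfolding X_def .
      qed
      have vnot: "{v} \<notin> ?Q (a \<bullet> v)" by simp
      obtain z where z: "z \<in> \<Union>C" "a \<bullet> z < a \<bullet> v" using False by blast
      have "nonevasive {F \<in> C. v \<in> F \<and> (\<exists>x\<in>F. a \<bullet> x < a \<bullet> v)}"
        using v(1) by (intro nonevasive_descending_link[OF C conv _ z IH]) auto
      also have "{F \<in> C. v \<in> F \<and> (\<exists>x\<in>F. a \<bullet> x < a \<bullet> v)} = comparables (?Q t - X) {v}"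
      proof (intro equalityI subsetI)
        fix F assume "F \<in> {F \<in> C. v \<in> F \<and> (\<exists>x\<in>F. a \<bullet> x < a \<bullet> v)}"
        then have F: "F \<in> ?Q (a \<bullet> v)" "v \<in> F" by blast+
        then have "{v} \<subset> F" using vnot by blast
        with F(1) show "F \<in> comparables (?Q t - X) {v}"
          unfolding X comparables_def by blast
      next
        fix F assume "F \<in> comparables (?Q t - X) {v}"
        then have F: "F \<in> ?Q (a \<bullet> v)" "{v} \<subset> F \<or> F \<subset> {v}"
          unfolding X comparables_def by blast+
        then have "F \<noteq> {}" by blast
        with F show "F \<in> {F \<in> C. v \<in> F \<and> (\<exists>x\<in>F. a \<bullet> x < a \<bullet> v)}" by blast
      qed
      finally have link: "nonevasive (comparables (?Q t - X) {v})" .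
      have delete: "insert e B - {e} = B" if "e \<notin> B" for B :: "'a set set" and e
        using that by blast
      have "?Q t - X - {{v}} = ?Q (a \<bullet> v)" unfolding X by (rule delete[OF vnot])
      with lower have rest: "nonevasive (?Q t - X - {{v}})" by (simp only:)
      have v_mem: "{v} \<in> ?Q t - X" unfolding X by (rule insertI1)
      from nonevasive.remove[OF v_mem link rest] have rest: "nonevasive (?Q t - X)" .
      have up: "x \<in> ?Q t" "x \<notin> ?Q (a \<bullet> v)" "x \<noteq> {v}" "v \<in> x" if "x \<in> X" for x
      proof -
        note diff = that[unfolded X_def Diff_iff singleton_iff]
        show x: "x \<in> ?Q t" "x \<notin> ?Q (a \<bullet> v)" "x \<noteq> {v}"
          by (rule diff[THEN conjunct1, THEN conjunct1] diff[THEN conjunct1, THEN conjunct2]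
              diff[THEN conjunct2])+
        show "v \<in> x" by (rule upper[OF x(1,2)])
      qed
      have cone: "y \<subseteq> {v} \<or> {v} \<subseteq> y" if x: "x \<in> X" and y: "y \<in> comparables (?Q t) x" for x y
      proof (cases "x \<subset> y")
        case True
        then show ?thesis using up(4)[OF x] by blast
      next
        case False
        then have y: "y \<in> ?Q t" "y \<subset> x" using y unfolding comparables_def by blast+
        have "y \<notin> ?Q (a \<bullet> v)" using up(1,2)[OF x] y(2) by blast
        from upper[OF y(1) this] show ?thesis by simp
      qed
      have apex: "{v} \<in> comparables (?Q t) x" if "x \<in> X" for x
        using up(3,4)[OF that] vQ unfolding comparables_def by blast
      have "X \<subseteq> ?Q t" using up(1) by (rule subsetI)
      from nonevasive_remove_cones[OF finite_subset[OF this finQ] finQ this v_mem apex cone rest]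
      show ?thesis .
    qed
  qed
qed

text \<open>Taken at a high enough level \<open>t\<close>, the sublevel family is the whole complex, so the sweep provides the step
of an induction on the dimension of the union.\<close>
theorem nonevasive_cell_complex:
  fixes C :: "'a::euclidean_space set set"
  assumes "cell_complex C" "C \<noteq> {}" "convex (\<Union>C)"
  shows "nonevasive C"
  using assms
proof (induction "nat (aff_dim (\<Union>C))" arbitrary: C rule: less_induct)
  case less
  note C = less.prems(1)
  from ex_generic_functional[OF C] obtain a where
    inj: "\<forall>v w. {v} \<in> C \<longrightarrow> {w} \<in> C \<longrightarrow> a \<bullet> v = a \<bullet> w \<longrightarrow> v = w" and
    gen: "\<forall>F\<in>C. (\<forall>x\<in>F. \<forall>y\<in>F. a \<bullet> x = a \<bullet> y) \<longrightarrow> (\<exists>v. F = {v})"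
    by (elim exE conjE)
  have "\<forall>F\<in>C. \<exists>p. p \<in> F" using cell_complexD(3)[OF C] by blast
  from bchoice[OF this] obtain p where p: "\<forall>F\<in>C. p F \<in> F" ..
  define t where "t = Max ((\<lambda>F. a \<bullet> p F) ` C) + 1"
  have "a \<bullet> p F < t" if "F \<in> C" for F
  proof -
    have "a \<bullet> p F \<le> Max ((\<lambda>F. a \<bullet> p F) ` C)"
      using cell_complexD(1)[OF C] that by (intro Max_ge finite_imageI imageI)
    then show ?thesis unfolding t_def by linarith
  qed
  then have all: "{F \<in> C. \<exists>x\<in>F. a \<bullet> x < t} = C" using p by blast
  have IH: "nonevasive C'"
    if C': "cell_complex C'" "C' \<noteq> {}" "convex (\<Union>C')" "aff_dim (\<Union>C') < aff_dim (\<Union>C)" for C' :: "'a set set"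
  proof (rule less.hyps[OF _ C'(1-3)])
    obtain F where "F \<in> C'" using C'(2) by blast
    then have "\<Union>C' \<noteq> {}" using cell_complexD(3)[OF C'(1)] by blast
    then have "0 \<le> aff_dim (\<Union>C')" using aff_dim_negative_iff[of "\<Union>C'"] by linarith
    then show "nat (aff_dim (\<Union>C')) < nat (aff_dim (\<Union>C))" using C'(4) by simp
  qed
  have "nonevasive {F \<in> C. \<exists>x\<in>F. a \<bullet> x < t}"
  proof (rule nonevasive_sublevel[OF C less.prems(3)])
    show "{F \<in> C. \<exists>x\<in>F. a \<bullet> x < t} \<noteq> {}" unfolding all by (rule less.prems(2))
    show "v = w" if "{v} \<in> C" "{w} \<in> C" "a \<bullet> v = a \<bullet> w" for v w
      by (rule inj[THEN spec, THEN spec, THEN mp, THEN mp, THEN mp, OF that])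
    show "\<exists>v. F = {v}" if "F \<in> C" "\<forall>x\<in>F. \<forall>y\<in>F. a \<bullet> x = a \<bullet> y" for F
      by (rule gen[THEN bspec, THEN mp, OF that])
  qed (rule IH)
  then show ?case unfolding all .
qed

section \<open>Collapsing the derived subdivision\<close>

text \<open>This is what makes the convex hulls of chains behave like simplices with the chosen points as vertices.
Let \<open>G\<close> be the largest member of the chain and \<open>p F\<close> a convex combination of the chosen points.  If
\<open>p G\<close> has positive weight, then \<open>p F\<close> is in the relative interior of \<open>G\<close>, which forces \<open>F = G\<close>;
otherwise \<open>G\<close> can be dropped from the chain.\<close>
lemma mem_chain_if_in_convex_hull:
  fixes C :: "'a::euclidean_space set set"
  assumes C: "cell_complex C" and p: "\<And>F. F \<in> C \<Longrightarrow> p F \<in> rel_interior F" and F: "F \<in> C"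
    and "c \<in> chains C" "p F \<in> convex hull (p ` c)"
  shows "F \<in> c"
proof -
  have pF: "p F \<in> F" using p[OF F] rel_interior_subset by blast
  have "finite c" "c \<subseteq> C" "\<And>A B. A \<in> c \<Longrightarrow> B \<in> c \<Longrightarrow> A \<subseteq> B \<or> B \<subseteq> A"
    using assms(4) cell_complexD(1)[OF C] finite_subset by (auto simp: chains_def chain_subset_def)
  then show ?thesis
    using assms(5)
  proof (induction c rule: finite_psubset_induct)
    case (psubset c)
    then have "c \<noteq> {}" by auto
    then obtain G where G: "G \<in> c" "\<And>B. B \<in> c \<Longrightarrow> G \<subseteq> B \<Longrightarrow> G = B"
      using finite_has_maximal[OF psubset.hyps(1)] by blast
    then have top: "B \<subseteq> G" if "B \<in> c" for B using psubset.prems(2) that by blast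
    have GC: "G \<in> C" using G(1) psubset.prems(1) by blast
    have "p B \<in> G" if "B \<in> c" for B
    proof -
      have "p B \<in> B" using p[of B] psubset.prems(1) rel_interior_subset[of B] that by blast
      then show ?thesis using top[OF that] by blast
    qed
    then have hull: "convex hull (p ` S) \<subseteq> G" if "S \<subseteq> c" for S
      using that by (intro hull_minimal cell_complexD(4)[OF C GC]) blast
    have "F \<subseteq> G"
      using cell_complexD(6)[OF C F GC p[OF F]] hull[OF order_refl] psubset.prems(3) by blast
    have is_top: "F \<in> c" if "p F \<in> rel_interior G"
      using cell_complexD(6)[OF C GC F that pF] \<open>F \<subseteq> G\<close> G(1) by simp
    have c: "p ` c = insert (p G) (p ` (c - {G}))" using G(1) by blast
    show ?case
    proof (cases "c - {G} = {}")
      case True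
      then have "p ` (c - {G}) = {}" by (simp only: image_empty)
      then have "p ` c = {p G}" using c by (simp only:)
      then have "p F = p G" using psubset.prems(3) by simp
      then show ?thesis using is_top p[OF GC] by simp
    next
      case False
      then have ne: "p ` (c - {G}) \<noteq> {}" by simp
      obtain u w b where uwb: "0 \<le> u" "0 \<le> w" "u + w = 1" "b \<in> convex hull (p ` (c - {G}))"
        "p F = u *\<^sub>R p G + w *\<^sub>R b"
        using psubset.prems(3) unfolding c convex_hull_insert[OF ne] by blast
      show ?thesis
      proof (cases "u = 0")
        case True
        then have "p F \<in> convex hull (p ` (c - {G}))" using uwb by simp
        moreover have "c - {G} \<subset> c" using G(1) by blast
        ultimately have "F \<in> c - {G}"
          using psubset.prems(1,2) by (intro psubset.IH) auto
        then show ?thesis by simp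
      next
        case False
        have "b \<in> G" using uwb(4) hull[of "c - {G}"] by blast
        then have "(1 - u) *\<^sub>R b + u *\<^sub>R p G \<in> rel_interior G"
          using False uwb(1-3) p[OF GC]
          by (intro rel_interior_segment cell_complexD(4)[OF C GC]) auto
        moreover have "w = 1 - u" using uwb(3) by simp
        ultimately have "p F \<in> rel_interior G" using uwb(5) by (simp add: add.commute)
        then show ?thesis by (rule is_top)
      qed
    qed
  qed
qed

lemma collapse_steps_image:
  fixes h :: "'b set \<Rightarrow> 'a::euclidean_space set"
  assumes "collapse_step\<^sup>*\<^sup>* K L"
    and emb: "\<And>s t. s \<in> K \<Longrightarrow> t \<in> K \<Longrightarrow> h s \<subseteq> h t \<longleftrightarrow> s \<subseteq> t"
    and empty: "{} \<in> K" "h {} = {}"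
  shows "elementary_collapse\<^sup>*\<^sup>* (h ` K) (h ` L)"
  using assms(1)
proof (induction rule: rtranclp_induct)
  case (step M N)
  have MK: "M \<subseteq> K" using step.hyps(1) by (rule collapse_steps_subset)
  have emb_less: "h s \<subset> h t \<longleftrightarrow> s \<subset> t" if "s \<in> M" "t \<in> M" for s t
    using that MK emb[of s t] emb[of t s] by blast
  have inj: "inj_on h M"
  proof (rule inj_onI)
    fix s t assume st: "s \<in> M" "t \<in> M" "h s = h t"
    then have "s \<in> K" "t \<in> K" using MK by blast+
    then show "s = t" using emb[of s t] emb[of t s] st(3) by simp
  qed
  obtain \<sigma> \<tau> where st: "\<sigma> \<in> M" "\<sigma> \<noteq> {}" "\<tau> \<in> M" "\<sigma> \<subset> \<tau>"
    and free: "\<forall>\<rho>\<in>M. \<sigma> \<subset> \<rho> \<longrightarrow> \<rho> = \<tau>" and N: "N = M - {\<sigma>, \<tau>}"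
    using step.hyps(2) unfolding collapse_step_def by blast
  have "free_face (h ` M) (h \<sigma>)"
    unfolding free_face_def
  proof (intro conjI ex1I[of _ "h \<tau>"])
    show "h \<sigma> \<in> h ` M" "h \<tau> \<in> h ` M" "h \<sigma> \<subset> h \<tau>" using st emb_less by auto
    show "h \<sigma> \<noteq> {}" using emb[of \<sigma> "{}"] MK st empty by auto
    show "\<rho> = h \<tau>" if "\<rho> \<in> h ` M \<and> h \<sigma> \<subset> \<rho>" for \<rho>
      using that free emb_less[OF st(1)] by blast
  qed
  moreover have "h ` N = h ` M - {h \<sigma>, h \<tau>}"
    unfolding N using inj_on_image_set_diff[OF inj, of M "{\<sigma>, \<tau>}"] st by simp
  moreover have "h \<tau> \<in> h ` M" "h \<sigma> \<subset> h \<tau>"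
    using st(4) by (simp_all add: st(3) emb_less[OF st(1,3)])
  ultimately have "elementary_collapse (h ` M) (h ` N)"
    unfolding elementary_collapse_def by (intro exI conjI)
  with step.IH show ?case by (rule rtranclp.rtrancl_into_rtrancl)
qed simp

theorem theorem4p0p5:
  fixes P :: "'a::euclidean_space set" and C D :: "'a set set" and d :: nat
  assumes "polytope P" and "aff_dim P = int d"
    and "polytopal_subdivision C P"
    and "derived_subdivision C D"
  shows "collapsible D"
proof -
  let ?Q = "C - {{}}"
  have UQ: "\<Union>?Q = P" using assms(3) by (auto simp: polytopal_subdivision_def)
  have Q: "cell_complex ?Q"
    using assms(3) by (intro polytopal_complex_imp_cell_complex) (simp add: polytopal_subdivision_def)
  have "P \<noteq> {}" using assms(2) by auto
  then have "?Q \<noteq> {}" using UQ by blast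
  moreover have "convex (\<Union>?Q)" unfolding UQ using assms(1) by (rule polytope_imp_convex)
  ultimately have "nonevasive ?Q" using Q by (intro nonevasive_cell_complex)
  then obtain w where w: "collapse_step\<^sup>*\<^sup>* (chains ?Q) {{}, {w}}"
    using nonevasive_imp_collapse by blast
  obtain p where p: "\<And>F. F \<in> ?Q \<Longrightarrow> p F \<in> rel_interior F"
    and D: "D = (\<lambda>c. convex hull (p ` c)) ` chains ?Q"
    using assms(4) unfolding derived_subdivision_def by blast
  have "elementary_collapse\<^sup>*\<^sup>* D ((\<lambda>c. convex hull (p ` c)) ` {{}, {w}})"
    unfolding D using w
  proof (rule collapse_steps_image)
    fix s t assume s: "s \<in> chains ?Q" and t: "t \<in> chains ?Q"
    show "convex hull (p ` s) \<subseteq> convex hull (p ` t) \<longleftrightarrow> s \<subseteq> t"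
    proof
      assume sub: "convex hull (p ` s) \<subseteq> convex hull (p ` t)"
      show "s \<subseteq> t"
      proof
        fix F assume F: "F \<in> s"
        then have "p F \<in> convex hull (p ` t)" using sub hull_subset[of "p ` s" convex] by blast
        moreover have "F \<in> ?Q" using F s by (auto simp: chains_def)
        ultimately show "F \<in> t" using mem_chain_if_in_convex_hull[OF Q p] t by blast
      qed
    qed (intro hull_mono image_mono)
  qed (auto simp: chains_def chain_subset_def)
  then show ?thesis unfolding collapsible_def by auto
qed

end
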